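(* Let $(L,\prec_1,\succ_1,\prec_2,\succ_2,\delta_1,\delta_2)$ be a compatible dendriDer pair. For $i\in\{1,2\}$ define the bilinear maps $\mu_i:L\times L\to L$ by $$\mu_i(x,y)=x\prec_iy+x\succ_iy.$$ Then $(L,\mu_1,\mu_2,\delta_1,\delta_2)$ is a compatible AssDer pair.
   Context: All vector spaces are over a field $\mathbb{K}$ of characteristic $0$. A dendriform algebra $(L,\prec,\succ)$ is a vector space with two bilinear operations such that for all $x,y,z$: $(x\prec y)\prec z=x\prec(y\prec z+y\succ z)$, $(x\succ y)\prec z=x\succ(y\prec z)$, $x\succ(y\succ z)=(x\prec y+x\succ y)\succ z$. A dendriDer pair $(L,\prec,\succ,\delta)$ is a dendriform algebra with a linear map $\delta:L\to L$ that is a derivation for both $\prec$ and $\succ$. A compatible dendriform algebra $(L,\prec_1,\succ_1,\prec_2,\succ_2)$ consists of two dendriform algebras $(L,\prec_1,\succ_1)$ and $(L,\prec_2,\succ_2)$ such that for all $x,y,z\in L$: $(x\prec_1y)\prec_2z+(x\prec_2y)\prec_1z=x\prec_2(y\prec_1z+y\succ_1z)+x\prec_1(y\prec_2z+y\succ_2z)$, $(x\succ_1y)\prec_2z+(x\succ_2y)\prec_1z=x\succ_2(y\prec_1z)+x\succ_1(y\prec_2z)$, $(x\prec_1y+x\succ_1y)\succ_2z+(x\prec_2y+x\succ_2y)\succ_1z=x\succ_2(y\succ_1z)+x\succ_1(y\succ_2z)$. A compatible dendriDer pair $(L,\prec_1,\succ_1,\prec_2,\succ_2,\delta_1,\delta_2)$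 consists of two dendriDer pairs $(L,\prec_1,\succ_1,\delta_1)$ and $(L,\prec_2,\succ_2,\delta_2)$ such that $(L,\prec_1,\succ_1,\prec_2,\succ_2)$ is a compatible dendriform algebra and for all $x,y\in L$: $\delta_1(x\prec_2y)+\delta_2(x\prec_1y)=\delta_1x\prec_2y+x\prec_2\delta_1y+\delta_2x\prec_1y+x\prec_1\delta_2y$, $\delta_1(x\succ_2y)+\delta_2(x\succ_1y)=\delta_1x\succ_2y+x\succ_2\delta_1y+\delta_2x\succ_1y+x\succ_1\delta_2y$. An AssDer pair $(L,\mu,\delta)$ is an associative algebra $(L,\mu)$ with a derivation $\delta$. A compatible AssDer pair $(L,\mu_1,\mu_2,\delta_1,\delta_2)$ consists of two AssDer pairs $(L,\mu_1,\delta_1)$, $(L,\mu_2,\delta_2)$ such that for all $x,y,z\in L$: $\mu_2(\mu_1(x,y),z)+\mu_1(\mu_2(x,y),z)=\mu_1(x,\mu_2(y,z))+\mu_2(x,\mu_1(y,z))$ and $\delta_1(\mu_2(x,y))+\delta_2(\mu_1(x,y))=\mu_2(\delta_1x,y)+\mu_2(x,\delta_1y)+\mu_1(\delta_2x,y)+\mu_1(x,\delta_2y)$. *)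

theory Defs
  imports Complex_Main
begin

text \<open>
  The ground field is an arbitrary field of characteristic zero (class \<^class>\<open>field_char_0\<close>),
  and vector spaces are instances of the library locale \<^locale>\<open>vector_space\<close>, whose
  underlying set is the whole type. The library's own notion of a bilinear map only covers real
  scalars.
\<close>

definition bilinear_map ::
    "('k::field_char_0 \<Rightarrow> 'v::ab_group_add \<Rightarrow> 'v) \<Rightarrow> ('v \<Rightarrow> 'v \<Rightarrow> 'v) \<Rightarrow> bool"
  where "bilinear_map scale f \<longleftrightarrow>
    (\<forall>x. Vector_Spaces.linear scale scale (\<lambda>y. f x y)) \<and>
    (\<forall>y. Vector_Spaces.linear scale scale (\<lambda>x. f x y))"

definition is_derivation :: "('v::ab_group_add \<Rightarrow> 'v \<Rightarrow> 'v) \<Rightarrow> ('v \<Rightarrow> 'v) \<Rightarrow> bool"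
  where "is_derivation f \<delta> \<longleftrightarrow> (\<forall>x y. \<delta> (f x y) = f (\<delta> x) y + f x (\<delta> y))"

subsection \<open>Dendriform algebras\<close>

locale dendriform_algebra = vector_space scale
  for scale :: "'k::field_char_0 \<Rightarrow> 'v::ab_group_add \<Rightarrow> 'v" +
  fixes prec :: "'v \<Rightarrow> 'v \<Rightarrow> 'v"  (infixl "\<prec>" 70)
    and succ :: "'v \<Rightarrow> 'v \<Rightarrow> 'v"  (infixl "\<succ>" 70)
  assumes bilinear_prec: "bilinear_map scale prec"
    and bilinear_succ: "bilinear_map scale succ"
    and prec_prec: "(x \<prec> y) \<prec> z = x \<prec> (y \<prec> z + y \<succ> z)"
    and succ_prec: "(x \<succ> y) \<prec> z = x \<succ> (y \<prec> z)"
    and succ_succ: "x \<succ> (y \<succ> z) = (x \<prec> y + x \<succ> y) \<succ> z"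

locale dendriDer_pair = dendriform_algebra scale prec succ
  for scale :: "'k::field_char_0 \<Rightarrow> 'v::ab_group_add \<Rightarrow> 'v"
    and prec :: "'v \<Rightarrow> 'v \<Rightarrow> 'v"
    and succ :: "'v \<Rightarrow> 'v \<Rightarrow> 'v" +
  fixes \<delta> :: "'v \<Rightarrow> 'v"
  assumes linear_deriv: "Vector_Spaces.linear scale scale \<delta>"
    and derivation_prec: "is_derivation prec \<delta>"
    and derivation_succ: "is_derivation succ \<delta>"

locale compatible_dendriform_algebra =
    dend1: dendriform_algebra scale prec1 succ1 +
    dend2: dendriform_algebra scale prec2 succ2
  for scale :: "'k::field_char_0 \<Rightarrow> 'v::ab_group_add \<Rightarrow> 'v"
    and prec1 :: "'v \<Rightarrow> 'v \<Rightarrow> 'v"  (infixl "\<prec>\<^sub>1" 70)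
    and succ1 :: "'v \<Rightarrow> 'v \<Rightarrow> 'v"  (infixl "\<succ>\<^sub>1" 70)
    and prec2 :: "'v \<Rightarrow> 'v \<Rightarrow> 'v"  (infixl "\<prec>\<^sub>2" 70)
    and succ2 :: "'v \<Rightarrow> 'v \<Rightarrow> 'v"  (infixl "\<succ>\<^sub>2" 70) +
  assumes compat_prec_prec:
      "(x \<prec>\<^sub>1 y) \<prec>\<^sub>2 z + (x \<prec>\<^sub>2 y) \<prec>\<^sub>1 z =
       x \<prec>\<^sub>2 (y \<prec>\<^sub>1 z + y \<succ>\<^sub>1 z) + x \<prec>\<^sub>1 (y \<prec>\<^sub>2 z + y \<succ>\<^sub>2 z)"
    and compat_succ_prec:
      "(x \<succ>\<^sub>1 y) \<prec>\<^sub>2 z + (x \<succ>\<^sub>2 y) \<prec>\<^sub>1 z =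
       x \<succ>\<^sub>2 (y \<prec>\<^sub>1 z) + x \<succ>\<^sub>1 (y \<prec>\<^sub>2 z)"
    and compat_succ_succ:
      "(x \<prec>\<^sub>1 y + x \<succ>\<^sub>1 y) \<succ>\<^sub>2 z + (x \<prec>\<^sub>2 y + x \<succ>\<^sub>2 y) \<succ>\<^sub>1 z =
       x \<succ>\<^sub>2 (y \<succ>\<^sub>1 z) + x \<succ>\<^sub>1 (y \<succ>\<^sub>2 z)"

locale compatible_dendriDer_pair =
    pair1: dendriDer_pair scale prec1 succ1 \<delta>\<^sub>1 +
    pair2: dendriDer_pair scale prec2 succ2 \<delta>\<^sub>2 +
    compatible_dendriform_algebra scale prec1 succ1 prec2 succ2
  for scale :: "'k::field_char_0 \<Rightarrow> 'v::ab_group_add \<Rightarrow> 'v"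
    and prec1 :: "'v \<Rightarrow> 'v \<Rightarrow> 'v"  (infixl "\<prec>\<^sub>1" 70)
    and succ1 :: "'v \<Rightarrow> 'v \<Rightarrow> 'v"  (infixl "\<succ>\<^sub>1" 70)
    and prec2 :: "'v \<Rightarrow> 'v \<Rightarrow> 'v"  (infixl "\<prec>\<^sub>2" 70)
    and succ2 :: "'v \<Rightarrow> 'v \<Rightarrow> 'v"  (infixl "\<succ>\<^sub>2" 70)
    and \<delta>\<^sub>1 :: "'v \<Rightarrow> 'v"
    and \<delta>\<^sub>2 :: "'v \<Rightarrow> 'v" +
  assumes compat_deriv_prec:
      "\<delta>\<^sub>1 (x \<prec>\<^sub>2 y) + \<delta>\<^sub>2 (x \<prec>\<^sub>1 y) =
       \<delta>\<^sub>1 x \<prec>\<^sub>2 y + x \<prec>\<^sub>2 \<delta>\<^sub>1 y + \<delta>\<^sub>2 x \<prec>\<^sub>1 y + x \<prec>\<^sub>1 \<delta>\<^sub>2 y"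
    and compat_deriv_succ:
      "\<delta>\<^sub>1 (x \<succ>\<^sub>2 y) + \<delta>\<^sub>2 (x \<succ>\<^sub>1 y) =
       \<delta>\<^sub>1 x \<succ>\<^sub>2 y + x \<succ>\<^sub>2 \<delta>\<^sub>1 y + \<delta>\<^sub>2 x \<succ>\<^sub>1 y + x \<succ>\<^sub>1 \<delta>\<^sub>2 y"

subsection \<open>Associative algebras\<close>

text \<open>Associative algebras are not required to be unital.\<close>

locale associative_algebra = vector_space scale
  for scale :: "'k::field_char_0 \<Rightarrow> 'v::ab_group_add \<Rightarrow> 'v" +
  fixes \<mu> :: "'v \<Rightarrow> 'v \<Rightarrow> 'v"
  assumes bilinear_mult: "bilinear_map scale \<mu>"
    and mult_assoc: "\<mu> (\<mu> x y) z = \<mu> x (\<mu> y z)"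

locale AssDer_pair = associative_algebra scale \<mu>
  for scale :: "'k::field_char_0 \<Rightarrow> 'v::ab_group_add \<Rightarrow> 'v"
    and \<mu> :: "'v \<Rightarrow> 'v \<Rightarrow> 'v" +
  fixes \<delta> :: "'v \<Rightarrow> 'v"
  assumes linear_deriv: "Vector_Spaces.linear scale scale \<delta>"
    and derivation_mult: "is_derivation \<mu> \<delta>"

locale compatible_AssDer_pair =
    pair1: AssDer_pair scale \<mu>\<^sub>1 \<delta>\<^sub>1 +
    pair2: AssDer_pair scale \<mu>\<^sub>2 \<delta>\<^sub>2
  for scale :: "'k::field_char_0 \<Rightarrow> 'v::ab_group_add \<Rightarrow> 'v"
    and \<mu>\<^sub>1 :: "'v \<Rightarrow> 'v \<Rightarrow> 'v"
    and \<mu>\<^sub>2 :: "'v \<Rightarrow> 'v \<Rightarrow> 'v"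
    and \<delta>\<^sub>1 :: "'v \<Rightarrow> 'v"
    and \<delta>\<^sub>2 :: "'v \<Rightarrow> 'v" +
  assumes compat_mult:
      "\<mu>\<^sub>2 (\<mu>\<^sub>1 x y) z + \<mu>\<^sub>1 (\<mu>\<^sub>2 x y) z = \<mu>\<^sub>1 x (\<mu>\<^sub>2 y z) + \<mu>\<^sub>2 x (\<mu>\<^sub>1 y z)"
    and compat_deriv:
      "\<delta>\<^sub>1 (\<mu>\<^sub>2 x y) + \<delta>\<^sub>2 (\<mu>\<^sub>1 x y) =
       \<mu>\<^sub>2 (\<delta>\<^sub>1 x) y + \<mu>\<^sub>2 x (\<delta>\<^sub>1 y) + \<mu>\<^sub>1 (\<delta>\<^sub>2 x) y + \<mu>\<^sub>1 x (\<delta>\<^sub>2 y)"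

end

theory Submission
  imports Defs
begin

text \<open>The dendriform axioms split associativity into three pieces: added together, their left
  sides give \<open>(x y) z\<close> and their right sides \<open>x (y z)\<close> for the product
  \<open>prec + succ\<close>. The compatibility axioms are the cross terms obtained by putting sums
  of the two structures into the dendriform and Leibniz identities, so they add up in the same way
  to the compatibility of the products and derivations. What remains is additivity of the operations
  and of \<delta>. \<open>associative_algebra_sum\<close> and \<open>AssDer_pair_sum\<close> treat
  one structure, \<open>compatible_AssDer_pair_sum\<close> the mixed identities.\<close>

lemma bilinear_map_add_left:
  assumes "bilinear_map scale f"
  shows "f (x + y) z = f x z + f y z"
  using assms
  unfolding bilinear_map_def Vector_Spaces.linear_iff by blast

lemma bilinear_map_add_right:
  assumes "bilinear_map scale f"
  shows "f x (y + z) = f x y + f x z"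
  using assms unfolding bilinear_map_def Vector_Spaces.linear_iff by blast

lemma bilinear_map_add:
  assumes "bilinear_map scale f" "bilinear_map scale g"
  shows "bilinear_map scale (\<lambda>x y. f x y + g x y)"
  using assms unfolding bilinear_map_def Vector_Spaces.linear_iff
  \<comment> \<open>Homogeneity of the sum comes from distributivity of scalars over vector
    addition, \<open>vector_space_assms(1)\<close>.\<close>
  by (auto simp: algebra_simps vector_space.vector_space_assms(1))

lemma linear_add:
  assumes "Vector_Spaces.linear scale scale f"
  shows "f (x + y) = f x + f y"
  using assms unfolding Vector_Spaces.linear_iff by blast

context dendriform_algebra
begin

lemmas bilinear_add =
  bilinear_map_add_left[OF bilinear_prec] bilinear_map_add_right[OF bilinear_prec]
  bilinear_map_add_left[OF bilinear_succ] bilinear_map_add_right[OF bilinear_succ]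

lemma associative_algebra_sum: "associative_algebra scale (\<lambda>x y. x \<prec> y + x \<succ> y)"
proof unfold_locales
  show "bilinear_map scale (\<lambda>x y. x \<prec> y + x \<succ> y)"
    by (rule bilinear_map_add[OF bilinear_prec bilinear_succ])
  show "(x \<prec> y + x \<succ> y) \<prec> z + (x \<prec> y + x \<succ> y) \<succ> z =
      x \<prec> (y \<prec> z + y \<succ> z) + x \<succ> (y \<prec> z + y \<succ> z)" for x y z
  proof -
    \<comment> \<open>The first two axioms settle the products ending in \<open>\<prec> z\<close>;
      the third, read from right to left, supplies the missing
      \<open>x \<succ> (y \<succ> z)\<close>.\<close>
    have "(x \<prec> y + x \<succ> y) \<prec> z = x \<prec> (y \<prec> z + y \<succ> z) + x \<succ> (y \<prec> z)"
      by (simp only: bilinear_add(1) prec_prec succ_prec)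
    then show ?thesis
      by (simp only: succ_succ[symmetric] bilinear_add(4) add.assoc)
  qed
qed

end

text \<open>For a fixed additive \<delta>, the Leibniz rule is preserved under adding
  products.\<close>

lemma (in dendriDer_pair) AssDer_pair_sum: "AssDer_pair scale (\<lambda>x y. prec x y + succ x y) \<delta>"
proof (intro AssDer_pair.intro AssDer_pair_axioms.intro)
  show "associative_algebra scale (\<lambda>x y. prec x y + succ x y)"
    by (rule associative_algebra_sum)
  show "Vector_Spaces.linear scale scale \<delta>"
    by (rule linear_deriv)
  show "is_derivation (\<lambda>x y. prec x y + succ x y) \<delta>"
    using derivation_prec derivation_succ
    by (simp add: is_derivation_def linear_add[OF linear_deriv] ac_simps)
qed

lemma (in compatible_dendriDer_pair) compatible_AssDer_pair_sum:
  "compatible_AssDer_pair scale (\<lambda>x y. x \<prec>\<^sub>1 y + x \<succ>\<^sub>1 y) (\<lambda>x y. x \<prec>\<^sub>2 y + x \<succ>\<^sub>2 y) \<delta>\<^sub>1 \<delta>\<^sub>2"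
proof (intro compatible_AssDer_pair.intro compatible_AssDer_pair_axioms.intro)
  show "AssDer_pair scale (\<lambda>x y. x \<prec>\<^sub>1 y + x \<succ>\<^sub>1 y) \<delta>\<^sub>1"
    by (rule pair1.AssDer_pair_sum)
  show "AssDer_pair scale (\<lambda>x y. x \<prec>\<^sub>2 y + x \<succ>\<^sub>2 y) \<delta>\<^sub>2"
    by (rule pair2.AssDer_pair_sum)
next
  fix x y z
  show "(x \<prec>\<^sub>1 y + x \<succ>\<^sub>1 y) \<prec>\<^sub>2 z + (x \<prec>\<^sub>1 y + x \<succ>\<^sub>1 y) \<succ>\<^sub>2 z +
      ((x \<prec>\<^sub>2 y + x \<succ>\<^sub>2 y) \<prec>\<^sub>1 z + (x \<prec>\<^sub>2 y + x \<succ>\<^sub>2 y) \<succ>\<^sub>1 z) =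
      x \<prec>\<^sub>1 (y \<prec>\<^sub>2 z + y \<succ>\<^sub>2 z) + x \<succ>\<^sub>1 (y \<prec>\<^sub>2 z + y \<succ>\<^sub>2 z) +
      (x \<prec>\<^sub>2 (y \<prec>\<^sub>1 z + y \<succ>\<^sub>1 z) + x \<succ>\<^sub>2 (y \<prec>\<^sub>1 z + y \<succ>\<^sub>1 z))"
    (is "?l = ?r")
  proof -
    \<comment> \<open>Each bracket is the left side of one mixed axiom. The factors before an outer
      \<succ> stay as sums, since \<open>compat_succ_succ\<close> needs them in that form.\<close>
    have "?l = ((x \<prec>\<^sub>1 y) \<prec>\<^sub>2 z + (x \<prec>\<^sub>2 y) \<prec>\<^sub>1 z) + ((x \<succ>\<^sub>1 y) \<prec>\<^sub>2 z + (x \<succ>\<^sub>2 y) \<prec>\<^sub>1 z) +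
        ((x \<prec>\<^sub>1 y + x \<succ>\<^sub>1 y) \<succ>\<^sub>2 z + (x \<prec>\<^sub>2 y + x \<succ>\<^sub>2 y) \<succ>\<^sub>1 z)"
      by (simp only: pair1.bilinear_add pair2.bilinear_add ac_simps)
    also have "\<dots> = ?r"
      unfolding compat_prec_prec compat_succ_prec compat_succ_succ
      by (simp only: pair1.bilinear_add pair2.bilinear_add ac_simps)
    finally show ?thesis .
  qed
next
  fix x y
  show "\<delta>\<^sub>1 (x \<prec>\<^sub>2 y + x \<succ>\<^sub>2 y) + \<delta>\<^sub>2 (x \<prec>\<^sub>1 y + x \<succ>\<^sub>1 y) =
      \<delta>\<^sub>1 x \<prec>\<^sub>2 y + \<delta>\<^sub>1 x \<succ>\<^sub>2 y + (x \<prec>\<^sub>2 \<delta>\<^sub>1 y + x \<succ>\<^sub>2 \<delta>\<^sub>1 y) +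
      (\<delta>\<^sub>2 x \<prec>\<^sub>1 y + \<delta>\<^sub>2 x \<succ>\<^sub>1 y) + (x \<prec>\<^sub>1 \<delta>\<^sub>2 y + x \<succ>\<^sub>1 \<delta>\<^sub>2 y)"
    (is "?l = ?r")
  proof -
    \<comment> \<open>Additivity of both derivations separates the \<prec> terms from the \<succ>
      terms, one mixed Leibniz rule for each.\<close>
    have "?l = (\<delta>\<^sub>1 (x \<prec>\<^sub>2 y) + \<delta>\<^sub>2 (x \<prec>\<^sub>1 y)) + (\<delta>\<^sub>1 (x \<succ>\<^sub>2 y) + \<delta>\<^sub>2 (x \<succ>\<^sub>1 y))"
      by (simp only: linear_add[OF pair1.linear_deriv] linear_add[OF pair2.linear_deriv] ac_simps)
    also have "\<dots> = ?r"
      unfolding compat_deriv_prec compat_deriv_succ by (simp only: ac_simps)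
    finally show ?thesis .
  qed
qed

theorem proposition4p7:
  fixes scale :: "'k::field_char_0 \<Rightarrow> 'v::ab_group_add \<Rightarrow> 'v"
    and prec1 succ1 prec2 succ2 :: "'v \<Rightarrow> 'v \<Rightarrow> 'v"
    and \<delta>\<^sub>1 \<delta>\<^sub>2 :: "'v \<Rightarrow> 'v"
    and \<mu>\<^sub>1 \<mu>\<^sub>2 :: "'v \<Rightarrow> 'v \<Rightarrow> 'v"
  assumes "compatible_dendriDer_pair scale prec1 succ1 prec2 succ2 \<delta>\<^sub>1 \<delta>\<^sub>2"
    and "\<And>x y. \<mu>\<^sub>1 x y = prec1 x y + succ1 x y"
    and "\<And>x y. \<mu>\<^sub>2 x y = prec2 x y + succ2 x y"
  shows "compatible_AssDer_pair scale \<mu>\<^sub>1 \<mu>\<^sub>2 \<delta>\<^sub>1 \<delta>\<^sub>2"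
proof -
  \<comment> \<open>Extensionality turns the pointwise descriptions into equations of functions,
    which can be rewritten inside the locale predicate.\<close>
  have "\<mu>\<^sub>1 = (\<lambda>x y. prec1 x y + succ1 x y)" "\<mu>\<^sub>2 = (\<lambda>x y. prec2 x y + succ2 x y)"
    using assms(2,3) by blast+
  then show ?thesis
    using compatible_dendriDer_pair.compatible_AssDer_pair_sum[OF assms(1)] by simp
qed

end
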